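(* Let $W>0$, $K^*=2\lceil W\rceil+1$ and $\bar\gamma>0$. Let $Y_1,\dots,Y_{K^*}$ be i.i.d. $\mathrm{Exp}(1)$ random variables and $X_{\max}=\max_{1\le k\le K^*}Y_k$. Then the ergodic capacity under the EDoF model, $\bar C=\mathbb E\left[\log_2(1+\bar\gamma X_{\max})\right]$, admits the closed form $$\bar C=\frac{K^*}{\ln 2}\sum_{j=0}^{K^*-1}\binom{K^*-1}{j}\frac{(-1)^j}{j+1}\,e^{(j+1)/\bar\gamma}\,E_1\!\left(\frac{j+1}{\bar\gamma}\right),$$ where $E_1(z)=\int_z^\infty t^{-1}e^{-t}\,dt$ is the exponential integral.
   Context: $W$ is the normalized aperture of a linear fluid antenna and $\bar\gamma$ is the average SNR. In the EDoF (equivalent degrees of freedom) model the best-port normalized gain is modeled as the maximum of $K^*$ i.i.d. unit-mean exponential variables. *)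

theory Defs
  imports "HOL-Probability.Probability"
begin

(* Only meant for z > 0; for z \<le> 0 the integrand is not integrable and the value is junk. *)
definition E1 :: "real \<Rightarrow> real" where
  "E1 z = (LBINT t:{z..}. exp (- t) / t)"

(* The conversion to nat does not truncate for W > 0, where the integer is at least 3. *)
definition edof_ports :: "real \<Rightarrow> nat" where
  "edof_ports W = nat (2 * \<lceil>W\<rceil> + 1)"

definition best_gain :: "(nat \<Rightarrow> 'a \<Rightarrow> real) \<Rightarrow> nat \<Rightarrow> 'a \<Rightarrow> real" where
  "best_gain Y K \<omega> = Max ((\<lambda>k. Y k \<omega>) ` {1..K})"

definition rate :: "real \<Rightarrow> real \<Rightarrow> real" where
  "rate snr x = log 2 (1 + snr * x)"

definition ergodic_capacity :: "'a measure \<Rightarrow> real \<Rightarrow> ('a \<Rightarrow> real) \<Rightarrow> real" where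
  "ergodic_capacity M snr X = (\<integral>\<omega>. rate snr (X \<omega>) \<partial>M)"

end

theory Submission
  imports Defs
begin

text \<open>The layer-cake formula turns the expectation of ln (1 + snr X) for X \<ge> 0 into the integral of
  the tail P(X > x) against the derivative snr / (1 + snr x). The tail 1 - (1 - exp (-x))^K of the
  maximum expands into exponentials by the binomial theorem, and the affine substitution
  t = c (x + 1/snr) turns the integral of each exponential exp (-c x) into an E1 term.\<close>

text \<open>With \<open>t = c / s + c * x\<close> the measure \<open>s / (1 + s * x) dx\<close>
  becomes \<open>dt / t\<close>, and the shift by \<open>c / s\<close> costs the factor
  \<open>exp (c / s)\<close>. Integrability is bundled with the value so that finite linear
  combinations inherit both.\<close>

lemma has_bochner_integral_exp_over_affine:
  fixes c s :: real
  assumes "c > 0" "s > 0"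
  shows "has_bochner_integral lborel (\<lambda>x. indicator {0..} x * (s / (1 + s * x)) * exp (- c * x))
           (exp (c / s) * E1 (c / s))"
proof -
  let ?f = "\<lambda>x::real. indicator {0..} x * (s / (1 + s * x)) * exp (- c * x)"
  let ?g = "\<lambda>t::real. indicator {c / s..} t *\<^sub>R (exp (- t) / t)"
  \<comment> \<open>Since \<open>1 + s * x\<close> is at least 1 on the half-line,
    \<open>s * exp (- c * x)\<close> dominates.\<close>
  have int: "integrable lborel ?f"
  proof (rule Bochner_Integration.integrable_bound)
    show "integrable lborel (\<lambda>x. s * (indicator {0<..} x *\<^sub>R exp (- (x * c))))"
      using integrable_I0i_exp_mscale[OF assms(1)]
      unfolding set_integrable_def by (rule integrable_mult_right)
    show "?f \<in> borel_measurable lborel"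
      by measurable
    \<comment> \<open>The bound fails at 0: the majorant lives on the open half-line and vanishes
      there, while \<open>?f 0 = s > 0\<close>. The exceptional point is null.\<close>
    have "norm (?f x) \<le> norm (s * (indicator {0<..} x *\<^sub>R exp (- (x * c))))" if "x \<noteq> 0" for x
    proof (cases "x > 0")
      case True
      have "s / (1 + s * x) \<le> s"
        using True assms by (simp add: divide_le_eq)
      then have "s / (1 + s * x) * exp (- (c * x)) \<le> s * exp (- (c * x))"
        by (rule mult_right_mono) simp
      moreover have "0 \<le> s / (1 + s * x)"
        using True assms by simp
      ultimately show ?thesis
        using True assms by (simp add: abs_mult mult.commute)
    qed (use that in auto)
    then show "AE x in lborel. norm (?f x) \<le> norm (s * (indicator {0<..} x *\<^sub>R exp (- (x * c))))"
      using AE_lborel_singleton[of "0::real"] by (auto elim!: eventually_mono)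
  qed
  \<comment> \<open>The leading \<open>c\<close> is the Jacobian. As \<open>c > 0\<close>, the
    condition \<open>t \<ge> c / s\<close> is exactly \<open>x \<ge> 0\<close>, so both sides vanish
    for negative \<open>x\<close>.\<close>
  have subst: "c * ?g (c / s + c * x) = exp (- (c / s)) * ?f x" for x
  proof (cases "x \<ge> 0")
    case True
    have "1 + s * x > 0"
      using True assms by (intro add_pos_nonneg) auto
    moreover have "c / s + c * x = c * (1 + s * x) / s"
      using assms by (simp add: field_simps)
    ultimately have ratio: "c / (c / s + c * x) = s / (1 + s * x)"
      using assms by simp
    have split: "exp (- (c / s + c * x)) = exp (- (c / s)) * exp (- c * x)"
      by (simp add: exp_add [symmetric])
    have "c / s \<le> c / s + c * x"
      using True assms by simp
    then have "c * ?g (c / s + c * x) = c / (c / s + c * x) * exp (- (c / s + c * x))"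
      by simp
    also have "\<dots> = s / (1 + s * x) * (exp (- (c / s)) * exp (- c * x))"
      using ratio split by (simp only:)
    finally show ?thesis
      using True by simp
  next
    case False
    then show ?thesis
      using assms by (simp add: zero_le_mult_iff)
  qed
  have "E1 (c / s) = c * (\<integral>x. ?g (c / s + c * x) \<partial>lborel)"
    unfolding E1_def set_lebesgue_integral_def
    using lborel_integral_real_affine[of c ?g "c / s"] assms by simp
  also have "\<dots> = (\<integral>x. c * ?g (c / s + c * x) \<partial>lborel)"
    by (rule integral_mult_right_zero [symmetric])
  also have "\<dots> = (\<integral>x. exp (- (c / s)) * ?f x \<partial>lborel)"
    by (simp only: subst)
  also have "\<dots> = exp (- (c / s)) * (\<integral>x. ?f x \<partial>lborel)"
    by (rule integral_mult_right_zero)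
  finally have "exp (c / s) * E1 (c / s) = (\<integral>x. ?f x \<partial>lborel)"
    by (simp add: exp_minus)
  with int show ?thesis
    by (simp add: has_bochner_integral_iff)
qed

text \<open>The integrand is the derivative of \<open>ln (1 + s * x)\<close>. The half-open interval
  matches the strict tail event \<open>x < X \<omega>\<close> used below; adding the null endpoint
  gives the closed interval required by the fundamental theorem of calculus.\<close>

lemma nn_integral_ln_layer:
  fixes s y :: real
  assumes "s > 0" "y \<ge> 0"
  shows "(\<integral>\<^sup>+x. ennreal (s / (1 + s * x)) * indicator {0..<y} x \<partial>lborel) = ennreal (ln (1 + s * y))"
proof -
  have pos: "1 + s * x > 0" if "x \<ge> 0" for x
    using that assms by (intro add_pos_nonneg) auto
  have "AE x in lborel. indicator {0..<y} x = (indicator {0..y} x :: ennreal)"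
    using AE_lborel_singleton[of y] by (auto elim!: eventually_mono split: split_indicator)
  then have "(\<integral>\<^sup>+x. ennreal (s / (1 + s * x)) * indicator {0..<y} x \<partial>lborel)
      = (\<integral>\<^sup>+x. ennreal (s / (1 + s * x)) * indicator {0..y} x \<partial>lborel)"
    by (intro nn_integral_cong_AE) (auto elim!: eventually_mono)
  also have "\<dots> = ennreal (ln (1 + s * y) - ln (1 + s * 0))"
  proof (rule nn_integral_FTC_Icc)
    fix x assume "x \<in> {0..y}"
    then have "1 + s * x > 0"
      by (intro pos) auto
    then show "((\<lambda>x. ln (1 + s * x)) has_real_derivative s / (1 + s * x)) (at x)"
      by (auto intro!: derivative_eq_intros)
    show "0 \<le> s / (1 + s * x)"
      using \<open>1 + s * x > 0\<close> assms by simp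
  qed (use assms in auto)
  finally show ?thesis
    by simp
qed

context prob_space
begin

text \<open>Tonelli for the nonnegative kernel on pairs with \<open>0 \<le> x < X \<omega>\<close>.
  Working in \<open>ennreal\<close> leaves finiteness to be read off later from the right-hand
  side.\<close>

lemma nn_integral_ln_eq_tail:
  fixes X :: "'a \<Rightarrow> real"
  assumes X[measurable]: "X \<in> borel_measurable M"
    and nonneg: "AE \<omega> in M. 0 \<le> X \<omega>" and s: "s > 0"
  shows "(\<integral>\<^sup>+\<omega>. ennreal (ln (1 + s * X \<omega>)) \<partial>M)
      = (\<integral>\<^sup>+x. ennreal (indicator {0..} x * (s / (1 + s * x)) * prob {\<omega> \<in> space M. x < X \<omega>}) \<partial>lborel)"
proof -
  interpret P: pair_sigma_finite M lborel
    by standard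
  \<comment> \<open>The indicator of a set depending on \<open>\<omega>\<close> is rewritten as a
    condition on the pair, whose joint measurability is then immediate.\<close>
  let ?h = "\<lambda>\<omega> x. ennreal (s / (1 + s * x)) * (if 0 \<le> x \<and> x < X \<omega> then 1 else 0)"
  have ind: "indicator {0..<X \<omega>} x = (if 0 \<le> x \<and> x < X \<omega> then 1 else 0 :: ennreal)" for \<omega> x
    by (simp add: indicator_def)
  have "(\<integral>\<^sup>+\<omega>. ennreal (ln (1 + s * X \<omega>)) \<partial>M) = (\<integral>\<^sup>+\<omega>. (\<integral>\<^sup>+x. ?h \<omega> x \<partial>lborel) \<partial>M)"
    using nonneg
    by (intro nn_integral_cong_AE, elim eventually_mono)
      (simp only: ind [symmetric] nn_integral_ln_layer [OF s])
  also have "\<dots> = (\<integral>\<^sup>+x. (\<integral>\<^sup>+\<omega>. ?h \<omega> x \<partial>M) \<partial>lborel)"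
    by (rule P.Fubini' [symmetric]) measurable
  also have "\<dots> = (\<integral>\<^sup>+x. ennreal (indicator {0..} x * (s / (1 + s * x))
      * prob {\<omega> \<in> space M. x < X \<omega>}) \<partial>lborel)"
  proof (intro nn_integral_cong)
    fix x :: real
    show "(\<integral>\<^sup>+\<omega>. ?h \<omega> x \<partial>M)
        = ennreal (indicator {0..} x * (s / (1 + s * x)) * prob {\<omega> \<in> space M. x < X \<omega>})"
    proof (cases "x \<ge> 0")
      case True
      have "(\<integral>\<^sup>+\<omega>. ?h \<omega> x \<partial>M)
          = (\<integral>\<^sup>+\<omega>. ennreal (s / (1 + s * x)) * indicator {\<omega> \<in> space M. x < X \<omega>} \<omega> \<partial>M)"
        using True by (intro nn_integral_cong) (simp add: indicator_def)
      also have "\<dots> = ennreal (s / (1 + s * x)) * emeasure M {\<omega> \<in> space M. x < X \<omega>}"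
        by (rule nn_integral_cmult_indicator) measurable
      finally show ?thesis
        using True s by (simp add: emeasure_eq_measure ennreal_mult [symmetric])
    qed simp
  qed
  finally show ?thesis .
qed

text \<open>A maximum is at most \<open>a\<close> iff every component is, so by independence the
  distribution function is a product of equal factors.\<close>

lemma prob_Max_exponential_le:
  assumes "finite I" "I \<noteq> {}" "l > 0" "a \<ge> 0"
    and ind: "indep_vars (\<lambda>_. borel) Y I"
    and exp: "\<And>k. k \<in> I \<Longrightarrow> distributed M lborel (Y k) (exponential_density l)"
  shows "prob {\<omega> \<in> space M. Max ((\<lambda>k. Y k \<omega>) ` I) \<le> a} = (1 - exp (- a * l)) ^ card I"
proof -
  have "{\<omega> \<in> space M. Max ((\<lambda>k. Y k \<omega>) ` I) \<le> a} = (\<Inter>k\<in>I. Y k -` {..a} \<inter> space M)"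
    using assms(1,2) by auto
  also have "prob \<dots> = (\<Prod>k\<in>I. prob (Y k -` {..a} \<inter> space M))"
    by (rule indep_varsD_finite [OF ind]) (use assms in auto)
  also have "\<dots> = (\<Prod>k\<in>I. 1 - exp (- a * l))"
  proof (intro prod.cong refl)
    fix k assume "k \<in> I"
    have "Y k -` {..a} \<inter> space M = {\<omega> \<in> space M. Y k \<omega> \<le> a}"
      by auto
    then show "prob (Y k -` {..a} \<inter> space M) = 1 - exp (- a * l)"
      using exponential_distributedD_le [OF exp [OF \<open>k \<in> I\<close>] assms(4,3)] by simp
  qed
  finally show ?thesis
    by simp
qed

end

text \<open>The constant term of the binomial expansion cancels the leading 1; shifting the index by
  one leaves only positive powers of \<open>q\<close>, each of which becomes a decaying
  exponential.\<close>

lemma one_minus_power_binomial: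
  fixes q :: real
  assumes "K > 0"
  shows "1 - (1 - q) ^ K
    = real K * (\<Sum>j = 0..K - 1. real ((K - 1) choose j) * ((- 1) ^ j / real (j + 1)) * q ^ (j + 1))"
proof -
  obtain n where K: "K = Suc n"
    using assms by (cases K) auto
  have "(1 - q) ^ K = (\<Sum>i\<le>Suc n. real (Suc n choose i) * (- q) ^ i)"
    using binomial_ring [of "- q" 1 "Suc n"] by (simp add: K)
  also have "\<dots> = 1 + (\<Sum>j\<le>n. real (Suc n choose Suc j) * (- q) ^ Suc j)"
    by (subst sum.atMost_Suc_shift) simp
  also have "(\<Sum>j\<le>n. real (Suc n choose Suc j) * (- q) ^ Suc j)
      = (\<Sum>j\<le>n. - (real K * (real (n choose j) * ((- 1) ^ j / real (j + 1)) * q ^ (j + 1))))"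
  proof (intro sum.cong refl)
    fix j
    \<comment> \<open>The absorption identity is the source of both the factor \<open>K\<close> and
      the denominators \<open>j + 1\<close>.\<close>
    have "real (Suc n choose Suc j) = real (Suc n) * real (n choose j) / real (j + 1)"
      using arg_cong [OF Suc_times_binomial [of j n], of real]
      by (simp add: field_simps)
    moreover have "(- q) ^ Suc j = - ((- 1) ^ j * q ^ (j + 1))"
      by (subst power_minus) simp
    ultimately show "real (Suc n choose Suc j) * (- q) ^ Suc j
        = - (real K * (real (n choose j) * ((- 1) ^ j / real (j + 1)) * q ^ (j + 1)))"
      by (simp add: K)
  qed
  finally show ?thesis
    by (simp add: K sum_negf sum_distrib_left atMost_atLeast0)
qed

text \<open>The integrability conjunct ensures that the capacity is a genuine expectation and not
  the default value 0 of the Bochner integral.\<close>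

theorem theorem3:
  fixes M :: "'a measure" and Y :: "nat \<Rightarrow> 'a \<Rightarrow> real" and W snr :: real and K :: nat
  assumes "prob_space M"
    and "W > 0" and "snr > 0"
    and K: "K = edof_ports W"
    and "prob_space.indep_vars M (\<lambda>_. borel) Y {1..K}"
    and "\<And>k. k \<in> {1..K} \<Longrightarrow> distributed M lborel (Y k) (exponential_density 1)"
  shows "integrable M (\<lambda>\<omega>. rate snr (best_gain Y K \<omega>))
    \<and> ergodic_capacity M snr (best_gain Y K) =
        real K / ln 2 * (\<Sum>j = 0..K - 1.
          real ((K - 1) choose j) * ((- 1) ^ j / real (j + 1))
            * exp (real (j + 1) / snr) * E1 (real (j + 1) / snr))"
proof -
  interpret prob_space M
    by fact
  let ?X = "best_gain Y K"
  let ?a = "\<lambda>j. real ((K - 1) choose j) * ((- 1) ^ j / real (j + 1))"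
  \<comment> \<open>The capacity in nats; division by \<open>ln 2\<close> is postponed to the
    end.\<close>
  let ?S = "real K * (\<Sum>j = 0..K - 1. ?a j
    * (exp (real (j + 1) / snr) * E1 (real (j + 1) / snr)))"
  have "K > 0"
    using \<open>W > 0\<close> by (simp add: K edof_ports_def)
  then have ne: "{1..K} \<noteq> {}"
    by simp
  have Y[measurable]: "Y k \<in> borel_measurable M" if "k \<in> {1..K}" for k
    using distributed_measurable [OF assms(6) [OF that]] by simp
  have X[measurable]: "?X \<in> borel_measurable M"
    unfolding best_gain_def by (rule borel_measurable_Max) (auto intro: Y)
  have cdf: "prob {\<omega> \<in> space M. ?X \<omega> \<le> x} = (1 - exp (- x)) ^ K" if "x \<ge> 0" for x
    using prob_Max_exponential_le [of "{1..K}" 1 x Y] that ne assms(5,6)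
    by (simp add: best_gain_def)
  \<comment> \<open>The densities constrain the \<open>Y k\<close> only almost surely, so
    nonnegativity of the maximum is extracted from its distribution function at 0, which is
    \<open>0 ^ K\<close> with \<open>K > 0\<close>.\<close>
  have "prob {\<omega> \<in> space M. ?X \<omega> \<le> 0} = 0"
    using cdf [of 0] \<open>K > 0\<close> by simp
  then have "AE \<omega> in M. \<not> ?X \<omega> \<le> 0"
    by (subst (asm) prob_eq_0) (auto elim!: eventually_mono)
  then have nonneg: "AE \<omega> in M. 0 \<le> ?X \<omega>"
    by (auto elim!: eventually_mono)
  have tail: "prob {\<omega> \<in> space M. x < ?X \<omega>}
      = real K * (\<Sum>j = 0..K - 1. ?a j * exp (- real (j + 1) * x))" if "x \<ge> 0" for x
  proof -
    have "{\<omega> \<in> space M. x < ?X \<omega>} = space M - {\<omega> \<in> space M. ?X \<omega> \<le> x}"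
      by auto
    then have "prob {\<omega> \<in> space M. x < ?X \<omega>} = 1 - (1 - exp (- x)) ^ K"
      using cdf [OF that] by (simp add: prob_compl)
    moreover have "exp (- x) ^ (j + 1) = exp (- real (j + 1) * x)" for j
      using exp_of_nat_mult [of "j + 1" "- x"] by (metis minus_mult_commute)
    ultimately show ?thesis
      using one_minus_power_binomial [OF \<open>K > 0\<close>, of "exp (- x)"] by simp
  qed
  let ?f = "\<lambda>x. indicator {0..} x * (snr / (1 + snr * x)) * prob {\<omega> \<in> space M. x < ?X \<omega>}"
  \<comment> \<open>Linearity, with the affine lemma applied at \<open>c = j + 1\<close> for each
    \<open>j\<close>.\<close>
  have "has_bochner_integral lborel
      (\<lambda>x. real K * (\<Sum>j = 0..K - 1. ?a j
        * (indicator {0..} x * (snr / (1 + snr * x)) * exp (- real (j + 1) * x)))) ?S"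
    by (intro has_bochner_integral_mult_right has_bochner_integral_sum
        has_bochner_integral_exp_over_affine) (use \<open>snr > 0\<close> in auto)
  also have "(\<lambda>x. real K * (\<Sum>j = 0..K - 1. ?a j
        * (indicator {0..} x * (snr / (1 + snr * x)) * exp (- real (j + 1) * x)))) = ?f"
  proof
    fix x :: real
    show "real K * (\<Sum>j = 0..K - 1. ?a j
        * (indicator {0..} x * (snr / (1 + snr * x)) * exp (- real (j + 1) * x))) = ?f x"
    \<comment> \<open>The tail expansion is available only for \<open>x \<ge> 0\<close>; elsewhere
      the indicator kills both sides.\<close>
    proof (cases "x \<ge> 0")
      case True
      then show ?thesis
        by (simp only: tail [OF True] sum_distrib_left mult_ac)
    qed simp
  qed
  finally have bochner: "has_bochner_integral lborel ?f ?S" .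
  have f_nonneg: "0 \<le> ?f x" for x
    using \<open>snr > 0\<close> by (simp add: indicator_def)
  have "?S = (\<integral>x. ?f x \<partial>lborel)"
    using bochner by (simp add: has_bochner_integral_iff)
  \<comment> \<open>The sign is not visible in the alternating sum, but it is in the integral. It
    matters because \<open>ennreal\<close> truncates negative reals to 0.\<close>
  then have S_nonneg: "0 \<le> ?S"
    using f_nonneg by (simp add: Bochner_Integration.integral_nonneg)
  have "(\<integral>\<^sup>+\<omega>. ennreal (ln (1 + snr * ?X \<omega>)) \<partial>M) = ennreal ?S"
    unfolding nn_integral_ln_eq_tail [OF X nonneg \<open>snr > 0\<close>]
    using bochner f_nonneg
    by (subst nn_integral_eq_integral) (auto simp: has_bochner_integral_iff)
  \<comment> \<open>A finite nonnegative integral yields integrability and the real value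
    together.\<close>
  then have "has_bochner_integral M (\<lambda>\<omega>. ln (1 + snr * ?X \<omega>)) ?S"
    using nonneg S_nonneg \<open>snr > 0\<close>
    by (intro has_bochner_integral_nn_integral) (auto elim!: eventually_mono)
  then have "has_bochner_integral M (\<lambda>\<omega>. ln (1 + snr * ?X \<omega>) / ln 2) (?S / ln 2)"
    by (rule has_bochner_integral_divide_zero)
  then have "has_bochner_integral M (\<lambda>\<omega>. rate snr (?X \<omega>)) (?S / ln 2)"
    by (simp add: rate_def log_def)
  then show ?thesis
    by (simp add: has_bochner_integral_iff ergodic_capacity_def mult.assoc)
qed

end
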